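(* Let $R$ be a unital ring with involution $*$ and let $a\in R$. The following assertions are equivalent: (i) $a$ is EP, i.e. $a$ is both group and Moore-Penrose invertible and $a^\#=a^\dagger$. (ii) $a$ is Moore-Penrose invertible and $p_a=r_a$. (iii) $a$ is core invertible and $p_a=q_a$. (iv) $a$ is dual core invertible and $r_a=q_a$. (v) $a$ is core invertible and $a^\#=a^{\mathrm{core}}$. (vi) $a$ is dual core invertible and $a^\#=a_{\mathrm{core}}$. (vii) $a$ is both group and Moore-Penrose invertible and $a^\dagger=a^{\mathrm{core}}$. (viii) $a$ is both group and Moore-Penrose invertible and $a^\dagger=a_{\mathrm{core}}$. (ix) $a$ is both group and Moore-Penrose invertible and $a^{\mathrm{core}}=a_{\mathrm{core}}$.
   Context: For $a\in R$: $aR=\{ax:x\in R\}$, $Ra=\{xa:x\in R\}$. Inverses (each unique when it exists): the group inverse $a^\#$ is the $x$ with $axa=a$, $xax=x$, $ax=xa$; the Moore-Penrose inverse $a^\dagger$ is the $x$ with $axa=a$, $xax=x$, $(ax)^*=ax$, $(xa)^*=xa$; the core inverse $a^{\mathrm{core}}$ is the $x$ with $axa=a$, $xR=aR$, $Rx=Ra^*$; the dual core inverse $a_{\mathrm{core}}$ is the $x$ with $axa=a$, $xR=a^*R$, $Rx=Ra$. Idempotents (each unique when it exists): $p_a$ is the self-adjoint idempotent with $p_aR=aR$; $r_a$ is the self-adjoint idempotent with $Rr_a=Ra$; $q_a$ is the idempotent with $q_aR=aR$ and $Rq_a=Ra$. Known existence facts: $a$ is group invertible iff $q_a$ exists; Moore-Penrose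 invertible iff $p_a,r_a$ exist; core invertible iff $p_a,q_a$ exist; dual core invertible iff $r_a,q_a$ exist. In particular core or dual core invertible elements are group invertible, and elements that are both group and Moore-Penrose invertible are core and dual core invertible. *)

theory Defs
  imports Main
begin

text \<open>Rings with involution. The class \<open>ring_1\<close> is avoided because it demands \<open>0 \<noteq> 1\<close>;
  the sort \<open>{ring, monoid_mult}\<close> describes arbitrary unital rings, the trivial ring included.\<close>

class involution_ring = ring + monoid_mult +
  fixes star :: "'a \<Rightarrow> 'a"
  assumes star_star: "star (star x) = x"
    and star_add: "star (x + y) = star x + star y"
    and star_mult: "star (x * y) = star y * star x"

definition right_principal :: "'a::times \<Rightarrow> 'a set" where
  "right_principal a = {a * x | x. True}"

definition left_principal :: "'a::times \<Rightarrow> 'a set" where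
  "left_principal a = {x * a | x. True}"

definition idempotent :: "'a::times \<Rightarrow> bool" where
  "idempotent e \<longleftrightarrow> e * e = e"

definition self_adjoint :: "'a::involution_ring \<Rightarrow> bool" where
  "self_adjoint x \<longleftrightarrow> star x = x"

definition is_group_inverse :: "'a::times \<Rightarrow> 'a \<Rightarrow> bool" where
  "is_group_inverse a x \<longleftrightarrow> a * x * a = a \<and> x * a * x = x \<and> a * x = x * a"

definition is_mp_inverse :: "'a::involution_ring \<Rightarrow> 'a \<Rightarrow> bool" where
  "is_mp_inverse a x \<longleftrightarrow>
     a * x * a = a \<and> x * a * x = x \<and> star (a * x) = a * x \<and> star (x * a) = x * a"

definition is_core_inverse :: "'a::involution_ring \<Rightarrow> 'a \<Rightarrow> bool" where
  "is_core_inverse a x \<longleftrightarrow>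
     a * x * a = a \<and> right_principal x = right_principal a \<and>
     left_principal x = left_principal (star a)"

definition is_dual_core_inverse :: "'a::involution_ring \<Rightarrow> 'a \<Rightarrow> bool" where
  "is_dual_core_inverse a x \<longleftrightarrow>
     a * x * a = a \<and> right_principal x = right_principal (star a) \<and>
     left_principal x = left_principal a"

definition is_p :: "'a::involution_ring \<Rightarrow> 'a \<Rightarrow> bool" where
  "is_p a e \<longleftrightarrow> idempotent e \<and> self_adjoint e \<and> right_principal e = right_principal a"

definition is_r :: "'a::involution_ring \<Rightarrow> 'a \<Rightarrow> bool" where
  "is_r a e \<longleftrightarrow> idempotent e \<and> self_adjoint e \<and> left_principal e = left_principal a"

definition is_q :: "'a::times \<Rightarrow> 'a \<Rightarrow> bool" where
  "is_q a e \<longleftrightarrow> idempotent e \<and> right_principal e = right_principal a \<and>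
     left_principal e = left_principal a"

definition group_invertible :: "'a::times \<Rightarrow> bool" where
  "group_invertible a \<longleftrightarrow> (\<exists>x. is_group_inverse a x)"

definition mp_invertible :: "'a::involution_ring \<Rightarrow> bool" where
  "mp_invertible a \<longleftrightarrow> (\<exists>x. is_mp_inverse a x)"

definition core_invertible :: "'a::involution_ring \<Rightarrow> bool" where
  "core_invertible a \<longleftrightarrow> (\<exists>x. is_core_inverse a x)"

definition dual_core_invertible :: "'a::involution_ring \<Rightarrow> bool" where
  "dual_core_invertible a \<longleftrightarrow> (\<exists>x. is_dual_core_inverse a x)"

text \<open>The following descriptions are meaningful only where the described element exists; it is
  then unique, by the lemmas at the end of this theory.\<close>

definition group_inverse :: "'a::times \<Rightarrow> 'a" where
  "group_inverse a = (THE x. is_group_inverse a x)"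

definition mp_inverse :: "'a::involution_ring \<Rightarrow> 'a" where
  "mp_inverse a = (THE x. is_mp_inverse a x)"

definition core_inverse :: "'a::involution_ring \<Rightarrow> 'a" where
  "core_inverse a = (THE x. is_core_inverse a x)"

definition dual_core_inverse :: "'a::involution_ring \<Rightarrow> 'a" where
  "dual_core_inverse a = (THE x. is_dual_core_inverse a x)"

definition p_idem :: "'a::involution_ring \<Rightarrow> 'a" where
  "p_idem a = (THE e. is_p a e)"

definition r_idem :: "'a::involution_ring \<Rightarrow> 'a" where
  "r_idem a = (THE e. is_r a e)"

definition q_idem :: "'a::times \<Rightarrow> 'a" where
  "q_idem a = (THE e. is_q a e)"

definition EP :: "'a::involution_ring \<Rightarrow> bool" where
  "EP a \<longleftrightarrow> group_invertible a \<and> mp_invertible a \<and> group_inverse a = mp_inverse a"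

lemma right_principal_eqD:
  fixes a b :: "'a::monoid_mult"
  assumes "right_principal a = right_principal b"
  obtains u v where "a = b * u" "b = a * v"
proof -
  have "a \<in> right_principal a" "b \<in> right_principal b"
    unfolding right_principal_def using mult_1_right by (metis (mono_tags, lifting) mem_Collect_eq)+
  then have "a \<in> right_principal b" "b \<in> right_principal a" using assms by auto
  then show thesis using that by (auto simp: right_principal_def)
qed

lemma left_principal_eqD:
  fixes a b :: "'a::monoid_mult"
  assumes "left_principal a = left_principal b"
  obtains u v where "a = u * b" "b = v * a"
proof -
  have "a \<in> left_principal a" "b \<in> left_principal b"
    unfolding left_principal_def using mult_1_left by (metis (mono_tags, lifting) mem_Collect_eq)+
  then have "a \<in> left_principal b" "b \<in> left_principal a" using assms by auto
  then show thesis using that by (auto simp: left_principal_def)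
qed

lemma group_inverse_unique:
  fixes a :: "'a::monoid_mult"
  assumes "is_group_inverse a x" "is_group_inverse a y"
  shows "x = y"
  using assms unfolding is_group_inverse_def by (metis mult.assoc)

lemma mp_inverse_unique:
  fixes a :: "'a::involution_ring"
  assumes x: "is_mp_inverse a x" and y: "is_mp_inverse a y"
  shows "x = y"
proof -
  have "star (a * x) = star (a * y * (a * x))"
    using y unfolding is_mp_inverse_def by (metis mult.assoc)
  then have 1: "a * x = a * x * (a * y)"
    using x y unfolding is_mp_inverse_def by (metis star_mult)
  then have 1: "a * x = a * y"
    using x unfolding is_mp_inverse_def by (metis mult.assoc)
  have "star (x * a) = star (x * a * (y * a))"
    using y unfolding is_mp_inverse_def by (metis mult.assoc)
  then have "x * a = y * a * (x * a)"
    using x y unfolding is_mp_inverse_def by (metis star_mult)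
  then have 2: "x * a = y * a"
    using x unfolding is_mp_inverse_def by (metis mult.assoc)
  show ?thesis
    using x y 1 2 unfolding is_mp_inverse_def by (metis mult.assoc)
qed

lemma core_inverse_props:
  fixes a :: "'a::involution_ring"
  assumes "is_core_inverse a x"
  shows "star (a * x) = a * x" "x * a * a = a" "\<exists>u. x = a * u" "\<exists>t. x = t * star a"
proof -
  have ax: "a * x * a = a" using assms by (simp add: is_core_inverse_def)
  obtain u v where u: "x = a * u" and v: "a = x * v"
    using assms right_principal_eqD unfolding is_core_inverse_def by metis
  obtain s t where s: "x = s * star a" and t: "star a = t * x"
    using assms left_principal_eqD unfolding is_core_inverse_def by metis
  have "star a * star (a * x) = star a" using ax by (metis star_mult)
  then have x: "x * star (a * x) = x" using s by (metis mult.assoc)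
  then have eq: "a * x * star (a * x) = a * x" by (simp add: mult.assoc)
  then show sa: "star (a * x) = a * x" by (metis star_mult star_star)
  have "x * (a * x) = x" using x sa by simp
  then show "x * a * a = a" using v by (metis mult.assoc)
  show "\<exists>u. x = a * u" "\<exists>t. x = t * star a" using u s by blast+
qed

lemma core_inverse_unique:
  fixes a :: "'a::involution_ring"
  assumes x: "is_core_inverse a x" and y: "is_core_inverse a y"
  shows "x = y"
proof -
  have "star a * (a * y) = star a"
    using y core_inverse_props(1)[OF y] unfolding is_core_inverse_def by (metis star_mult)
  then have 1: "x * (a * y) = x" using core_inverse_props(4)[OF x] by (metis mult.assoc)
  have 2: "x * a * y = y"
    using core_inverse_props(2)[OF x] core_inverse_props(3)[OF y] by (metis mult.assoc)
  show ?thesis using 1 2 by (simp add: mult.assoc)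
qed

lemma star_right_principal:
  "star ` right_principal a = left_principal (star (a::'a::involution_ring))"
  unfolding right_principal_def left_principal_def
  by (auto simp: image_iff star_mult) (metis star_mult star_star)

lemma star_left_principal:
  "star ` left_principal a = right_principal (star (a::'a::involution_ring))"
  unfolding right_principal_def left_principal_def
  by (auto simp: image_iff star_mult) (metis star_mult star_star)

lemma dual_core_inverse_star:
  fixes a :: "'a::involution_ring"
  assumes "is_dual_core_inverse a x"
  shows "is_core_inverse (star a) (star x)"
  using assms unfolding is_core_inverse_def is_dual_core_inverse_def
  by (metis mult.assoc star_left_principal star_mult star_right_principal star_star)

lemma dual_core_inverse_unique:
  fixes a :: "'a::involution_ring"
  assumes "is_dual_core_inverse a x" "is_dual_core_inverse a y"
  shows "x = y"
  using core_inverse_unique assms[THEN dual_core_inverse_star] by (metis star_star)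

lemma p_idem_unique:
  fixes a :: "'a::involution_ring"
  assumes x: "is_p a e" and y: "is_p a f"
  shows "e = f"
proof -
  have "right_principal e = right_principal f" using x y by (simp add: is_p_def)
  then obtain u v where "e = f * u" "f = e * v" by (rule right_principal_eqD)
  then have "f * e = e" "e * f = f"
    using x y unfolding is_p_def idempotent_def by (metis mult.assoc)+
  then show ?thesis
    using x y unfolding is_p_def self_adjoint_def by (metis star_mult)
qed

lemma r_idem_unique:
  fixes a :: "'a::involution_ring"
  assumes x: "is_r a e" and y: "is_r a f"
  shows "e = f"
proof -
  have "left_principal e = left_principal f" using x y by (simp add: is_r_def)
  then obtain u v where "e = u * f" "f = v * e" by (rule left_principal_eqD)
  then have "e * f = e" "f * e = f"
    using x y unfolding is_r_def idempotent_def by (metis mult.assoc)+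
  then show ?thesis
    using x y unfolding is_r_def self_adjoint_def by (metis star_mult)
qed

lemma q_idem_unique:
  fixes a :: "'a::monoid_mult"
  assumes x: "is_q a e" and y: "is_q a f"
  shows "e = f"
proof -
  have "right_principal e = right_principal f" using x y by (simp add: is_q_def)
  then obtain u v where 1: "e = f * u" "f = e * v" by (rule right_principal_eqD)
  have "left_principal e = left_principal f" using x y by (simp add: is_q_def)
  then obtain s t where 2: "e = s * f" "f = t * e" by (rule left_principal_eqD)
  have "f * e = e" using 1 y unfolding is_q_def idempotent_def by (metis mult.assoc)
  moreover have "f * e = f" using 2 x unfolding is_q_def idempotent_def by (metis mult.assoc)
  ultimately show ?thesis by simp
qed

end

theory Submission
  imports Defs
begin

text \<open>In terms of a given inverse, the three idempotents are
  \<open>p\<^sub>a = a a\<^sup>\<dagger> = a x\<close>, \<open>r\<^sub>a = a\<^sup>\<dagger> a = y a\<close>, \<open>q\<^sub>a = a a\<^sup># = x a = a y\<close>,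
  where \<open>x\<close> is the core and \<open>y\<close> the dual core inverse. So (iii), (v), (vii) and (ix) each make
  \<open>x a\<close> self-adjoint; as \<open>x a\<close> is an idempotent generating \<open>a R\<close>, it then equals
  \<open>p\<^sub>a = a x\<close>, and \<open>x\<close> is both the group and the Moore-Penrose inverse of \<open>a\<close>. The remaining
  conditions are dual, or immediate.\<close>

section \<open>Principal ideals, values of the descriptions, and core inverses as solutions of
  equations\<close>

lemma right_principal_eqI:
  fixes a b :: "'a::semigroup_mult"
  assumes "a = b * u" "b = a * v"
  shows "right_principal a = right_principal b"
  using assms unfolding right_principal_def by (auto simp: mult.assoc) (metis mult.assoc)+

lemma left_principal_eqI:
  fixes a b :: "'a::semigroup_mult"
  assumes "a = u * b" "b = v * a"
  shows "left_principal a = left_principal b"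
  using assms unfolding left_principal_def by auto (metis mult.assoc)+

lemma group_inverse_eq:
  fixes a :: "'a::monoid_mult"
  shows "is_group_inverse a x \<Longrightarrow> group_inverse a = x"
  unfolding group_inverse_def by (blast intro: the_equality group_inverse_unique)

lemma mp_inverse_eq: "is_mp_inverse a x \<Longrightarrow> mp_inverse a = x"
  unfolding mp_inverse_def by (blast intro: the_equality mp_inverse_unique)

lemma core_inverse_eq: "is_core_inverse a x \<Longrightarrow> core_inverse a = x"
  unfolding core_inverse_def by (blast intro: the_equality core_inverse_unique)

lemma dual_core_inverse_eq: "is_dual_core_inverse a x \<Longrightarrow> dual_core_inverse a = x"
  unfolding dual_core_inverse_def by (blast intro: the_equality dual_core_inverse_unique)

lemma p_idem_eq: "is_p a e \<Longrightarrow> p_idem a = e"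
  unfolding p_idem_def by (blast intro: the_equality p_idem_unique)

lemma r_idem_eq: "is_r a e \<Longrightarrow> r_idem a = e"
  unfolding r_idem_def by (blast intro: the_equality r_idem_unique)

lemma q_idem_eq:
  fixes a :: "'a::monoid_mult"
  shows "is_q a e \<Longrightarrow> q_idem a = e"
  unfolding q_idem_def by (blast intro: the_equality q_idem_unique)

text \<open>Allows calculating with equations instead of ideals. Writing \<open>x = a * u\<close>
  turns \<open>x * a * a = a\<close> and \<open>a * x * a = a\<close> into
  \<open>x * a * x = x\<close> and \<open>a * x * x = x\<close>; conversely, explicit multipliers
  yield both ideal equalities.\<close>

lemma is_core_inverse_iff:
  "is_core_inverse a x \<longleftrightarrow>
     a * x * a = a \<and> x * a * x = x \<and> star (a * x) = a * x \<and> x * a * a = a \<and> a * x * x = x"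
  (is "_ \<longleftrightarrow> ?eqs")
proof
  assume core: "is_core_inverse a x"
  note props = core_inverse_props[OF core]
  have axa: "a * x * a = a" using core by (simp add: is_core_inverse_def)
  obtain u where u: "x = a * u" using props(3) by blast
  have "x * a * x = x" using u props(2) by (metis mult.assoc)
  moreover have "a * x * x = x" using u axa by (metis mult.assoc)
  ultimately show ?eqs using axa props by blast
next
  assume eqs: ?eqs
  have "right_principal x = right_principal a"
  proof (rule right_principal_eqI)
    show "x = a * (x * x)" using eqs by (simp add: mult.assoc)
    show "a = x * (a * a)" using eqs by (simp add: mult.assoc)
  qed
  moreover have "left_principal x = left_principal (star a)"
  proof (rule left_principal_eqI)
    \<comment> \<open>Both multipliers come from \<open>star (a * x) = a * x\<close>: expand
      \<open>x = x * star (a * x)\<close> and \<open>star a = star (a * x * a)\<close>.\<close>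
    show "x = x * star x * star a" using eqs by (metis mult.assoc star_mult)
    show "star a = star a * a * x" using eqs by (metis mult.assoc star_mult)
  qed
  ultimately show "is_core_inverse a x" using eqs by (simp add: is_core_inverse_def)
qed

text \<open>The involution carries the equations over from the core inverse \<open>star x\<close> of
  \<open>star a\<close>; the converse is checked directly with mirrored multipliers.\<close>

lemma is_dual_core_inverse_iff:
  "is_dual_core_inverse a x \<longleftrightarrow>
     a * x * a = a \<and> x * a * x = x \<and> star (x * a) = x * a \<and> a * a * x = a \<and> x * x * a = x"
  (is "_ \<longleftrightarrow> ?eqs")
proof
  assume "is_dual_core_inverse a x"
  then have "is_core_inverse (star a) (star x)" by (rule dual_core_inverse_star)
  then show ?eqs
    unfolding is_core_inverse_iff by (metis mult.assoc star_mult star_star)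
next
  assume eqs: ?eqs
  have "left_principal x = left_principal a"
  proof (rule left_principal_eqI)
    show "x = x * x * a" "a = a * a * x" using eqs by simp_all
  qed
  moreover have "right_principal x = right_principal (star a)"
  proof (rule right_principal_eqI)
    show "x = star a * (star x * x)" using eqs by (metis mult.assoc star_mult)
    show "star a = x * (a * star a)" using eqs by (metis mult.assoc star_mult)
  qed
  ultimately show "is_dual_core_inverse a x" using eqs by (simp add: is_dual_core_inverse_def)
qed

section \<open>The idempotents as products of \<open>a\<close> with an inverse\<close>

lemma is_p_mult_right:
  assumes "a * x * a = a" "star (a * x) = a * x"
  shows "is_p a (a * x)"
  unfolding is_p_def idempotent_def self_adjoint_def
  using assms right_principal_eqI[of "a * x" a x a] by (simp add: mult.assoc[symmetric])

text \<open>Moore-Penrose and dual core inverses share these assumptions, so one lemma serves both;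
  likewise \<open>is_p_mult_right\<close> serves Moore-Penrose and core inverses.\<close>

lemma is_r_mult_left:
  assumes "a * x * a = a" "star (x * a) = x * a"
  shows "is_r a (x * a)"
  unfolding is_r_def idempotent_def self_adjoint_def
  using assms left_principal_eqI[of "x * a" x a a] by (simp add: mult.assoc)

text \<open>For the right ideals, \<open>a * x * x = x\<close> puts \<open>x * a\<close> into that
  of \<open>a\<close>, and \<open>x * a * a = a\<close> gives the converse.\<close>

lemma is_q_core:
  assumes "is_core_inverse a x"
  shows "is_q a (x * a)"
proof -
  note eqs = assms[unfolded is_core_inverse_iff]
  have "right_principal (x * a) = right_principal a"
  proof (rule right_principal_eqI)
    show "x * a = a * (x * x * a)" "a = x * a * a" using eqs by (simp_all add: mult.assoc[symmetric])
  qed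
  moreover have "left_principal (x * a) = left_principal a"
  proof (rule left_principal_eqI)
    show "x * a = x * a" "a = a * (x * a)" using eqs by (simp_all add: mult.assoc)
  qed
  ultimately show ?thesis
    using eqs by (simp add: is_q_def idempotent_def mult.assoc[symmetric])
qed

lemma is_q_dual_core:
  assumes "is_dual_core_inverse a x"
  shows "is_q a (a * x)"
proof -
  note eqs = assms[unfolded is_dual_core_inverse_iff]
  have "right_principal (a * x) = right_principal a"
  proof (rule right_principal_eqI)
    show "a * x = a * x" "a = a * x * a" using eqs by simp_all
  qed
  moreover have "left_principal (a * x) = left_principal a"
  proof (rule left_principal_eqI)
    show "a * x = a * x * x * a" "a = a * (a * x)" using eqs by (simp_all add: mult.assoc)
  qed
  ultimately show ?thesis
    using eqs by (simp add: is_q_def idempotent_def mult.assoc[symmetric])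
qed

section \<open>Existence of one kind of inverse from others\<close>

lemma core_imp_group_invertible:
  assumes "is_core_inverse a x"
  shows "is_group_inverse a (x * x * a)"
proof -
  note eqs = assms[unfolded is_core_inverse_iff]
  \<comment> \<open>Both products of \<open>a\<close> with the candidate collapse to the idempotent
    \<open>x * a\<close>, which fixes \<open>a\<close> from either side.\<close>
  have "a * (x * x * a) = x * a" using eqs by (simp add: mult.assoc[symmetric])
  moreover have "x * x * a * a = x * a" using eqs by (simp add: mult.assoc)
  ultimately show ?thesis
    using eqs by (simp add: is_group_inverse_def mult.assoc[symmetric])
qed

lemma dual_core_imp_group_invertible:
  assumes "is_dual_core_inverse a x"
  shows "is_group_inverse a (a * x * x)"
proof -
  note eqs = assms[unfolded is_dual_core_inverse_iff]
  have "a * (a * x * x) = a * x" using eqs by (simp add: mult.assoc[symmetric])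
  moreover have "a * x * x * a = a * x" using eqs by (simp add: mult.assoc)
  ultimately show ?thesis
    using eqs by (simp add: is_group_inverse_def mult.assoc[symmetric])
qed

text \<open>The candidate has the required products: multiplying by \<open>a\<close> on the left
  gives the self-adjoint \<open>a * m\<close>, on the right the idempotent \<open>g * a\<close>,
  which fixes \<open>a\<close>.\<close>

lemma group_mp_imp_core:
  assumes g: "is_group_inverse a g" and m: "is_mp_inverse a m"
  shows "is_core_inverse a (g * a * m)"
proof -
  note gm = g[unfolded is_group_inverse_def] m[unfolded is_mp_inverse_def]
  have 1: "g * a * a = a" using gm by metis
  have 2: "a * (g * a * m) = a * m" using gm by (metis mult.assoc)
  have 3: "g * a * m * a = g * a" using gm by (metis mult.assoc)
  \<comment> \<open>\<open>g = a * g * g\<close> lies in the right ideal of \<open>a\<close>, on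
    which \<open>a * m\<close> is a left identity.\<close>
  have "a * m * g = a * m * (a * g * g)" using gm by metis
  also have "\<dots> = a * g * g" using gm by (metis mult.assoc)
  also have "\<dots> = g" using gm by simp
  finally have 4: "a * m * g = g" .
  have "g * a * (g * a * m) = g * a * m" using gm by (simp add: mult.assoc[symmetric])
  moreover have "a * m * (g * a * m) = g * a * m" using 4 by (simp add: mult.assoc[symmetric])
  ultimately show ?thesis
    unfolding is_core_inverse_iff 2 3 using gm 1 by blast
qed

lemma group_mp_imp_dual_core:
  assumes g: "is_group_inverse a g" and m: "is_mp_inverse a m"
  shows "is_dual_core_inverse a (m * a * g)"
proof -
  note gm = g[unfolded is_group_inverse_def] m[unfolded is_mp_inverse_def]
  have 1: "m * a * g * a = m * a" using gm by (metis mult.assoc)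
  have 2: "a * (m * a * g) = a * g" using gm by (simp add: mult.assoc[symmetric])
  have 3: "a * (a * g) = a" using gm by (metis mult.assoc)
  \<comment> \<open>Mirror image: \<open>g = g * (g * a)\<close> lies in the left ideal of
    \<open>a\<close>, on which \<open>m * a\<close> is a right identity.\<close>
  have "g * (m * a) = g * (g * a) * (m * a)" using gm by (metis mult.assoc)
  also have "\<dots> = g * (g * a)" using gm by (simp add: mult.assoc)
  also have "\<dots> = g" using gm by (metis mult.assoc)
  finally have 4: "g * (m * a) = g" .
  have "m * a * (m * a * g) = m * a * g" using gm by (simp add: mult.assoc[symmetric])
  moreover have "a * a * (m * a * g) = a" using 2 3 by (simp add: mult.assoc)
  moreover have "m * a * g * (m * a * g) * a = m * a * g"
    using 1 4 by (simp add: mult.assoc)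
  ultimately show ?thesis
    unfolding is_dual_core_inverse_iff 1 2 using gm by blast
qed

section \<open>Criteria for being EP\<close>

lemma EP_iff: "EP a \<longleftrightarrow> (\<exists>x. is_group_inverse a x \<and> is_mp_inverse a x)"
  unfolding EP_def group_invertible_def mp_invertible_def
  by (metis group_inverse_eq mp_inverse_eq)

lemma EP_if_core_self_adjoint:
  assumes core: "is_core_inverse a x" and sa: "star (x * a) = x * a"
  shows "EP a"
proof -
  note eqs = core[unfolded is_core_inverse_iff]
  have "is_p a (x * a)"
    using is_q_core[OF core] sa by (simp add: is_p_def is_q_def self_adjoint_def)
  moreover have "is_p a (a * x)" using eqs by (simp add: is_p_mult_right)
  ultimately have "a * x = x * a" using p_idem_unique by blast
  then show ?thesis
    unfolding EP_iff is_group_inverse_def is_mp_inverse_def using eqs sa by metis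
qed

text \<open>Here \<open>a * x\<close> generates the left ideal of \<open>a\<close>, so uniqueness of
  the \<open>is_r\<close> idempotent identifies it with \<open>x * a\<close>.\<close>

lemma EP_if_dual_core_self_adjoint:
  assumes dual: "is_dual_core_inverse a x" and sa: "star (a * x) = a * x"
  shows "EP a"
proof -
  note eqs = dual[unfolded is_dual_core_inverse_iff]
  have "is_r a (a * x)"
    using is_q_dual_core[OF dual] sa by (simp add: is_r_def is_q_def self_adjoint_def)
  moreover have "is_r a (x * a)" using eqs by (simp add: is_r_mult_left)
  ultimately have "a * x = x * a" using r_idem_unique by blast
  then show ?thesis
    unfolding EP_iff is_group_inverse_def is_mp_inverse_def using eqs sa by metis
qed

text \<open>With the next two lemmas, this turns (ii), (iii) and (iv) into
  \<open>a * x = x * a\<close> for the respective inverse \<open>x\<close>.\<close>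

lemma mp_idems:
  assumes "is_mp_inverse a x"
  shows "p_idem a = a * x" "r_idem a = x * a"
  using assms by (simp_all add: is_mp_inverse_def p_idem_eq r_idem_eq is_p_mult_right is_r_mult_left)

lemma core_idems:
  assumes "is_core_inverse a x"
  shows "p_idem a = a * x" "q_idem a = x * a"
  using assms q_idem_eq[OF is_q_core[OF assms]]
  by (simp_all add: is_core_inverse_iff p_idem_eq is_p_mult_right)

lemma dual_core_idems:
  assumes "is_dual_core_inverse a x"
  shows "r_idem a = x * a" "q_idem a = a * x"
  using assms q_idem_eq[OF is_q_dual_core[OF assms]]
  by (simp_all add: is_dual_core_inverse_iff r_idem_eq is_r_mult_left)

theorem theorem3p1:
  fixes a :: "'a::involution_ring"
  shows
    "(EP a \<longleftrightarrow> mp_invertible a \<and> p_idem a = r_idem a) \<and>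
     (EP a \<longleftrightarrow> core_invertible a \<and> p_idem a = q_idem a) \<and>
     (EP a \<longleftrightarrow> dual_core_invertible a \<and> r_idem a = q_idem a) \<and>
     (EP a \<longleftrightarrow> core_invertible a \<and> group_inverse a = core_inverse a) \<and>
     (EP a \<longleftrightarrow> dual_core_invertible a \<and> group_inverse a = dual_core_inverse a) \<and>
     (EP a \<longleftrightarrow> group_invertible a \<and> mp_invertible a \<and> mp_inverse a = core_inverse a) \<and>
     (EP a \<longleftrightarrow> group_invertible a \<and> mp_invertible a \<and> mp_inverse a = dual_core_inverse a) \<and>
     (EP a \<longleftrightarrow> group_invertible a \<and> mp_invertible a \<and> core_inverse a = dual_core_inverse a)"
proof -
  \<comment> \<open>All four inverses of an EP element coincide; this single witness settles the
    forward direction of every equivalence.\<close>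
  have EP_imp: "\<exists>x. is_group_inverse a x \<and> is_mp_inverse a x \<and>
      is_core_inverse a x \<and> is_dual_core_inverse a x \<and> a * x = x * a" if "EP a"
  proof -
    obtain x where g: "is_group_inverse a x" and m: "is_mp_inverse a x"
      using \<open>EP a\<close> by (auto simp: EP_iff)
    have "x * a * x = x" "a * x = x * a"
      using g by (simp_all add: is_group_inverse_def)
    \<comment> \<open>For \<open>g = m = x\<close> both candidates \<open>g * a * m\<close> and
      \<open>m * a * g\<close> reduce to \<open>x * a * x = x\<close>.\<close>
    then have "is_core_inverse a x" "is_dual_core_inverse a x"
      using group_mp_imp_core[OF g m] group_mp_imp_dual_core[OF g m] by simp_all
    then show ?thesis using g m \<open>a * x = x * a\<close> by blast
  qed
  have "EP a \<longleftrightarrow> mp_invertible a \<and> p_idem a = r_idem a" (is "_ \<longleftrightarrow> ?ii")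
  proof
    show ?ii if "EP a"
      using EP_imp[OF that] mp_idems unfolding mp_invertible_def by metis
    assume ?ii
    then obtain x where "is_mp_inverse a x" "a * x = x * a"
      using mp_idems unfolding mp_invertible_def by metis
    then show "EP a" unfolding EP_iff is_group_inverse_def is_mp_inverse_def by metis
  qed
  moreover have "EP a \<longleftrightarrow> core_invertible a \<and> p_idem a = q_idem a" (is "_ \<longleftrightarrow> ?iii")
  proof
    show ?iii if "EP a"
      using EP_imp[OF that] core_idems unfolding core_invertible_def by metis
    assume ?iii
    then obtain x where x: "is_core_inverse a x" and "a * x = x * a"
      using core_idems unfolding core_invertible_def by metis
    \<comment> \<open>A core inverse makes \<open>a * x\<close> self-adjoint, and commutation
      transfers this to \<open>x * a\<close>.\<close>
    then have "star (x * a) = x * a" by (metis is_core_inverse_iff)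
    with x show "EP a" by (rule EP_if_core_self_adjoint)
  qed
  moreover have "EP a \<longleftrightarrow> dual_core_invertible a \<and> r_idem a = q_idem a" (is "_ \<longleftrightarrow> ?iv")
  proof
    show ?iv if "EP a"
      using EP_imp[OF that] dual_core_idems unfolding dual_core_invertible_def by metis
    assume ?iv
    then obtain x where x: "is_dual_core_inverse a x" and "a * x = x * a"
      using dual_core_idems unfolding dual_core_invertible_def by metis
    then have "star (a * x) = a * x" by (metis is_dual_core_inverse_iff)
    with x show "EP a" by (rule EP_if_dual_core_self_adjoint)
  qed
  moreover have "EP a \<longleftrightarrow> core_invertible a \<and> group_inverse a = core_inverse a" (is "_ \<longleftrightarrow> ?v")
  proof
    show ?v if "EP a"
      using EP_imp[OF that] group_inverse_eq core_inverse_eq unfolding core_invertible_def by metis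
    assume ?v
    \<comment> \<open>Core invertibility supplies a group inverse, so \<open>group_inverse a\<close>
      denotes one and the equality makes \<open>x\<close> both inverses at once.\<close>
    then obtain x where x: "is_core_inverse a x" and "is_group_inverse a x"
      using core_imp_group_invertible group_inverse_eq core_inverse_eq
      unfolding core_invertible_def by metis
    then have "star (x * a) = x * a" by (metis is_core_inverse_iff is_group_inverse_def)
    with x show "EP a" by (rule EP_if_core_self_adjoint)
  qed
  moreover have "EP a \<longleftrightarrow> dual_core_invertible a \<and> group_inverse a = dual_core_inverse a"
    (is "_ \<longleftrightarrow> ?vi")
  proof
    show ?vi if "EP a"
      using EP_imp[OF that] group_inverse_eq dual_core_inverse_eq
      unfolding dual_core_invertible_def by metis
    assume ?vi
    then obtain x where x: "is_dual_core_inverse a x" and "is_group_inverse a x"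
      using dual_core_imp_group_invertible group_inverse_eq dual_core_inverse_eq
      unfolding dual_core_invertible_def by metis
    then have "star (a * x) = a * x" by (metis is_dual_core_inverse_iff is_group_inverse_def)
    with x show "EP a" by (rule EP_if_dual_core_self_adjoint)
  qed
  moreover have "EP a \<longleftrightarrow> group_invertible a \<and> mp_invertible a \<and> mp_inverse a = core_inverse a"
    (is "_ \<longleftrightarrow> ?vii")
  proof
    show ?vii if "EP a"
      using EP_imp[OF that] mp_inverse_eq core_inverse_eq
      unfolding group_invertible_def mp_invertible_def by metis
    assume ?vii
    \<comment> \<open>Group and Moore-Penrose invertibility together ensure that
      \<open>core_inverse a\<close> is a genuine core inverse.\<close>
    then obtain x where x: "is_core_inverse a x" and "is_mp_inverse a x"
      using group_mp_imp_core mp_inverse_eq core_inverse_eq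
      unfolding group_invertible_def mp_invertible_def by metis
    then have "star (x * a) = x * a" by (simp add: is_mp_inverse_def)
    with x show "EP a" by (rule EP_if_core_self_adjoint)
  qed
  moreover have "EP a \<longleftrightarrow> group_invertible a \<and> mp_invertible a \<and> mp_inverse a = dual_core_inverse a"
    (is "_ \<longleftrightarrow> ?viii")
  proof
    show ?viii if "EP a"
      using EP_imp[OF that] mp_inverse_eq dual_core_inverse_eq
      unfolding group_invertible_def mp_invertible_def by metis
    assume ?viii
    then obtain x where x: "is_dual_core_inverse a x" and "is_mp_inverse a x"
      using group_mp_imp_dual_core mp_inverse_eq dual_core_inverse_eq
      unfolding group_invertible_def mp_invertible_def by metis
    then have "star (a * x) = a * x" by (simp add: is_mp_inverse_def)
    with x show "EP a" by (rule EP_if_dual_core_self_adjoint)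
  qed
  moreover have "EP a \<longleftrightarrow> group_invertible a \<and> mp_invertible a \<and> core_inverse a = dual_core_inverse a"
    (is "_ \<longleftrightarrow> ?ix")
  proof
    show ?ix if "EP a"
      using EP_imp[OF that] core_inverse_eq dual_core_inverse_eq
      unfolding group_invertible_def mp_invertible_def by metis
    assume ?ix
    then obtain x where x: "is_core_inverse a x" and "is_dual_core_inverse a x"
      using group_mp_imp_core group_mp_imp_dual_core core_inverse_eq dual_core_inverse_eq
      unfolding group_invertible_def mp_invertible_def by metis
    \<comment> \<open>The dual core property of \<open>x\<close> is exactly what provides the
      self-adjointness that the core criterion asks for.\<close>
    then have "star (x * a) = x * a" by (simp add: is_dual_core_inverse_iff)
    with x show "EP a" by (rule EP_if_core_self_adjoint)
  qed
  ultimately show ?thesis by blast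
qed

end
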